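(* Let $n\ge2$ be an integer, $d_2=\gcd(2,n)$ and $d_3=\gcd(3,n)$. Then $$[\mathbb{D}_n^z]\circledcirc[\mathbb{T}\oplus\mathbb{Z}_2^c]=\{[\mathbb{1}],[\mathbb{Z}_2^-],[\mathbb{Z}_{d_2}],[\mathbb{Z}_{d_3}],[\mathbb{D}_{d_2}^z]\}.$$
   Context: $[K]$ is the conjugacy class of a subgroup $K$ in $\mathrm{O}(3)$, and the clips operation is $[H_1]\circledcirc[H_2]=\{[H_1\cap gH_2g^{-1}]:g\in\mathrm{O}(3)\}$. $(e_1,e_2,e_3)$ is the canonical basis of $\mathbb{R}^3$, $\mathbf{r}(n,\theta)$ is the rotation by angle $\theta$ about the axis directed by $n\neq0$. $\mathbb{1}=\{\mathrm{Id}\}$; $\mathbb{Z}_2^c=\{\pm\mathrm{Id}\}$; $H\oplus\mathbb{Z}_2^c=H\cup(-H)$ for $H\subset\mathrm{SO}(3)$; $\mathbb{Z}_k=\{\mathbf{r}(e_3,2j\pi/k):0\le j\le k-1\}$; $\mathbb{Z}_2^-=\{\mathrm{Id},-\mathbf{r}(e_3,\pi)\}$; $\mathbb{D}_k^z=\mathbb{Z}_k\cup(-\mathbf{r}(e_1,\pi))\mathbb{Z}_k$ for $k\ge2$. $\mathbb{T}$ is the rotation group of the regular tetrahedron (order 12), generated by $\mathbf{r}(e_3,\pi),\mathbf{r}(e_1,\pi),\mathbf{r}(e_1+e_2+e_3,2\pi/3)$. Conventions: $[\mathbb{Z}_1]=[\mathbb{1}]$, $[\mathbb{D}_1^z]=[\mathbb{Z}_2^-]$.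 *)

theory Defs
  imports "HOL-Analysis.Analysis" "HOL-Algebra.Generated_Groups"
begin

definition O3 :: "(real^3^3) monoid" where
  "O3 = \<lparr>carrier = {A. orthogonal_matrix A}, mult = (**), one = mat 1\<rparr>"

lemma group_O3: "group O3"
proof (rule groupI)
  fix A assume "A \<in> carrier O3"
  then show "\<exists>B\<in>carrier O3. B \<otimes>\<^bsub>O3\<^esub> A = \<one>\<^bsub>O3\<^esub>"
    by (intro bexI[of _ "transpose A"]) (auto simp: O3_def orthogonal_matrix_def)
qed (auto simp: O3_def orthogonal_matrix_mul orthogonal_matrix_id matrix_mul_assoc)

definition conj_set :: "('a, 'b) monoid_scheme \<Rightarrow> 'a \<Rightarrow> 'a set \<Rightarrow> 'a set" where
  "conj_set G g H = (\<lambda>h. g \<otimes>\<^bsub>G\<^esub> h \<otimes>\<^bsub>G\<^esub> inv\<^bsub>G\<^esub> g) ` H"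

definition conj_class :: "('a, 'b) monoid_scheme \<Rightarrow> 'a set \<Rightarrow> 'a set set" where
  "conj_class G H = {conj_set G g H | g. g \<in> carrier G}"

text \<open>The clips operation takes conjugacy classes as arguments. The definition ranges over all
  representatives; \<open>clips_conj_class\<close> below recovers the formula for one fixed choice of
  representatives.\<close>

definition clips :: "('a, 'b) monoid_scheme \<Rightarrow> 'a set set \<Rightarrow> 'a set set \<Rightarrow> 'a set set set" where
  "clips G C1 C2 = {conj_class G (H1 \<inter> conj_set G g H2) | H1 H2 g.
     H1 \<in> C1 \<and> H2 \<in> C2 \<and> g \<in> carrier G}"

context group
begin

lemma conj_set_subset:
  "g \<in> carrier G \<Longrightarrow> H \<subseteq> carrier G \<Longrightarrow> conj_set G g H \<subseteq> carrier G"
  by (auto simp: conj_set_def)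

lemma conj_set_mult:
  assumes "g \<in> carrier G" "h \<in> carrier G" "H \<subseteq> carrier G"
  shows "conj_set G (g \<otimes> h) H = conj_set G g (conj_set G h H)"
  unfolding conj_set_def image_image
  by (rule image_cong) (use assms in \<open>auto simp: inv_mult_group m_assoc subset_iff\<close>)

lemma conj_set_one: "H \<subseteq> carrier G \<Longrightarrow> conj_set G \<one> H = H"
  by (auto simp: conj_set_def subset_iff image_iff)

lemma conj_set_Int:
  assumes "g \<in> carrier G" "A \<subseteq> carrier G" "B \<subseteq> carrier G"
  shows "conj_set G g (A \<inter> B) = conj_set G g A \<inter> conj_set G g B"
  unfolding conj_set_def
  by (rule inj_on_image_Int[of _ "carrier G"])
     (use assms in \<open>auto simp: inj_on_def\<close>)

lemma conj_class_conj_set: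
  assumes a: "a \<in> carrier G" and H: "H \<subseteq> carrier G"
  shows "conj_class G (conj_set G a H) = conj_class G H"
proof -
  have "\<exists>g'\<in>carrier G. conj_set G g (conj_set G a H) = conj_set G g' H" if "g \<in> carrier G" for g
    using that a H by (intro bexI[of _ "g \<otimes> a"]) (auto simp: conj_set_mult)
  moreover have "\<exists>g'\<in>carrier G. conj_set G g H = conj_set G g' (conj_set G a H)"
    if g: "g \<in> carrier G" for g
  proof (intro bexI[of _ "g \<otimes> inv a"])
    have "conj_set G (g \<otimes> inv a) (conj_set G a H) = conj_set G (g \<otimes> inv a \<otimes> a) H"
      using g a H by (intro conj_set_mult[symmetric]) auto
    also have "g \<otimes> inv a \<otimes> a = g"
      using g a by (simp add: m_assoc)
    finally show "conj_set G g H = conj_set G (g \<otimes> inv a) (conj_set G a H)" ..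
  qed (use g a in auto)
  ultimately show ?thesis
    unfolding conj_class_def by blast
qed

lemma clips_conj_class:
  assumes H1: "H1 \<subseteq> carrier G" and H2: "H2 \<subseteq> carrier G"
  shows "clips G (conj_class G H1) (conj_class G H2) =
           {conj_class G (H1 \<inter> conj_set G g H2) | g. g \<in> carrier G}"
proof (intro equalityI subsetI)
  fix C assume "C \<in> clips G (conj_class G H1) (conj_class G H2)"
  then obtain a b g where abg: "a \<in> carrier G" "b \<in> carrier G" "g \<in> carrier G"
    and C: "C = conj_class G (conj_set G a H1 \<inter> conj_set G g (conj_set G b H2))"
    by (auto simp: clips_def conj_class_def)
  let ?k = "inv a \<otimes> (g \<otimes> b)"
  have k: "?k \<in> carrier G" using abg by auto
  have "a \<otimes> ?k = g \<otimes> b" using abg by (simp add: m_assoc[symmetric])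
  then have "conj_set G g (conj_set G b H2) = conj_set G a (conj_set G ?k H2)"
    using abg k H2 by (metis conj_set_mult m_closed)
  then have "C = conj_class G (conj_set G a (H1 \<inter> conj_set G ?k H2))"
    using abg k H1 H2 by (simp add: C conj_set_Int conj_set_subset)
  also have "\<dots> = conj_class G (H1 \<inter> conj_set G ?k H2)"
    using abg H1 by (intro conj_class_conj_set) auto
  finally show "C \<in> {conj_class G (H1 \<inter> conj_set G g H2) | g. g \<in> carrier G}"
    using k by blast
next
  fix C assume "C \<in> {conj_class G (H1 \<inter> conj_set G g H2) | g. g \<in> carrier G}"
  moreover have "H \<in> conj_class G H" if "H \<subseteq> carrier G" for H
    using conj_set_one[OF that] one_closed by (force simp: conj_class_def)
  ultimately show "C \<in> clips G (conj_class G H1) (conj_class G H2)"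
    using H1 H2 by (auto simp: clips_def)
qed

end

abbreviation e1 :: "real^3" where "e1 \<equiv> axis 1 1"
abbreviation e2 :: "real^3" where "e2 \<equiv> axis 2 1"
abbreviation e3 :: "real^3" where "e3 \<equiv> axis 3 1"

text \<open>Rodrigues' formula; the axis \<open>n \<noteq> 0\<close> need not be a unit vector, and the rotation is
  counterclockwise with respect to \<open>n\<close>.\<close>

definition rot :: "real^3 \<Rightarrow> real \<Rightarrow> real^3^3" where
  "rot n \<theta> = (let u = n /\<^sub>R norm n in
     matrix (\<lambda>v. cos \<theta> *\<^sub>R v + sin \<theta> *\<^sub>R cross3 u v + ((1 - cos \<theta>) * (u \<bullet> v)) *\<^sub>R u))"

definition triv_grp :: "(real^3^3) set" where
  "triv_grp = {mat 1}"

definition Z_grp :: "nat \<Rightarrow> (real^3^3) set" where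
  "Z_grp k = {rot e3 (2 * real j * pi / real k) | j. j < k}"

definition Z2minus :: "(real^3^3) set" where
  "Z2minus = {mat 1, - rot e3 pi}"

text \<open>For \<open>k = 1\<close> the convention \<open>[D\<^sub>1\<^sup>z] = [Z\<^sub>2\<^sup>-]\<close> is built in. (The convention
  \<open>[Z\<^sub>1] = [1]\<close> needs no special case, as \<open>rot e3 0 = mat 1\<close>.)\<close>

definition Dz_grp :: "nat \<Rightarrow> (real^3^3) set" where
  "Dz_grp k = (if k = 1 then Z2minus
               else Z_grp k \<union> (\<lambda>A. (- rot e1 pi) ** A) ` Z_grp k)"

definition T_grp :: "(real^3^3) set" where
  "T_grp = generate O3 {rot e3 pi, rot e1 pi, rot (e1 + e2 + e3) (2 * pi / 3)}"

definition plus_Z2c :: "(real^3^3) set \<Rightarrow> (real^3^3) set" where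
  "plus_Z2c H = H \<union> uminus ` H"

end

theory Submission
  imports Defs
begin

text \<open>
  The proof is uniform in the position \<open>g\<close> of the second group. Write \<open>Th g\<close> for the conjugate
  \<open>g (\<T> \<oplus> \<int>\<^sub>2\<^sup>c) g\<^sup>-\<^sup>1\<close>. The group \<open>\<D>\<^sub>n\<^sup>z\<close> consists of rotations \<open>zrot t\<close> about \<open>e\<^sub>3\<close>
  and reflections \<open>zref t\<close> in planes through \<open>e\<^sub>3\<close>, where \<open>t\<close> runs over the solutions of
  \<open>cos (n t) = 1\<close>, so only the rotations and reflections of \<open>Th g\<close> of these two shapes matter.

  Since \<open>\<T> \<oplus> \<int>\<^sub>2\<^sup>c\<close> is the group of signed cyclic permutation matrices
  (\<open>plus_Z2c_T_grp\<close>), traces and determinants, which conjugation preserves, tell everything needed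
  about \<open>Th g\<close>. Its rotations about \<open>e\<^sub>3\<close> form a cyclic group of order \<open>m \<in> {1, 2, 3}\<close>
  (\<open>Th_axial_rotations\<close>). Two of its reflections in planes through \<open>e\<^sub>3\<close> have equal or
  perpendicular planes (\<open>Th_zref_zref\<close>), so that no such reflection exists when \<open>m = 3\<close>.
  As the solutions of \<open>cos (m t) = 1\<close> and \<open>cos (n t) = 1\<close> have exactly the solutions of
  \<open>cos (gcd m n t) = 1\<close> in common, the intersection of \<open>\<D>\<^sub>n\<^sup>z\<close> with \<open>Th g\<close> is
  \<open>\<int>\<^sub>k\<close> with \<open>k = gcd m n\<close> if it contains no reflection, and a rotated copy of
  \<open>\<D>\<^sub>k\<^sup>z\<close> if it contains one; in the latter case \<open>m \<noteq> 3\<close>. For \<open>m = 1, 2, 3\<close> this leaves only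
  the five classes of the theorem.

  For the converse, a position with \<open>m = 2\<close> or \<open>m = 1\<close> for which \<open>zref 0 \<in> Th g\<close> yields
  \<open>[\<D>\<^sub>k\<^sup>z]\<close>; turning it slightly about \<open>e\<^sub>3\<close> keeps \<open>m\<close> and
  destroys all common reflections (\<open>Th_turn\<close>), which yields \<open>[\<int>\<^sub>k]\<close>. A position with a
  three-fold axis along \<open>e\<^sub>3\<close> yields the remaining class.
\<close>

section \<open>Explicit matrices\<close>

definition mat3 ::
  "real \<Rightarrow> real \<Rightarrow> real \<Rightarrow> real \<Rightarrow> real \<Rightarrow> real \<Rightarrow> real \<Rightarrow> real \<Rightarrow> real \<Rightarrow> real^3^3" where
  "mat3 a b c d e f g h i = vector [vector [a, b, c], vector [d, e, f], vector [g, h, i]]"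

lemma mat3_nth [simp]:
  "mat3 a b c d e f g h i $ 1 $ 1 = a" "mat3 a b c d e f g h i $ 1 $ 2 = b"
  "mat3 a b c d e f g h i $ 1 $ 3 = c" "mat3 a b c d e f g h i $ 2 $ 1 = d"
  "mat3 a b c d e f g h i $ 2 $ 2 = e" "mat3 a b c d e f g h i $ 2 $ 3 = f"
  "mat3 a b c d e f g h i $ 3 $ 1 = g" "mat3 a b c d e f g h i $ 3 $ 2 = h"
  "mat3 a b c d e f g h i $ 3 $ 3 = i"
  by (simp_all add: mat3_def)

lemma mat3_eq_iff:
  "mat3 a b c d e f g h i = mat3 a' b' c' d' e' f' g' h' i' \<longleftrightarrow>
     a = a' \<and> b = b' \<and> c = c' \<and> d = d' \<and> e = e' \<and> f = f' \<and> g = g' \<and> h = h' \<and> i = i'"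
  by (auto simp: vec_eq_iff forall_3)

lemma mat3_mult:
  "mat3 a b c d e f g h i ** mat3 a' b' c' d' e' f' g' h' i' =
     mat3 (a*a' + b*d' + c*g') (a*b' + b*e' + c*h') (a*c' + b*f' + c*i')
          (d*a' + e*d' + f*g') (d*b' + e*e' + f*h') (d*c' + e*f' + f*i')
          (g*a' + h*d' + i*g') (g*b' + h*e' + i*h') (g*c' + h*f' + i*i')"
  by (simp add: vec_eq_iff forall_3 matrix_matrix_mult_def sum_3)

lemma mat3_transpose: "transpose (mat3 a b c d e f g h i) = mat3 a d g b e h c f i"
  by (simp add: vec_eq_iff forall_3 transpose_def)

lemma mat3_uminus: "- mat3 a b c d e f g h i = mat3 (-a) (-b) (-c) (-d) (-e) (-f) (-g) (-h) (-i)"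
  by (simp add: vec_eq_iff forall_3)

lemma mat3_id: "mat 1 = mat3 1 0 0 0 1 0 0 0 1"
  by (simp add: vec_eq_iff forall_3 mat_def)

lemma mat3_trace: "trace (mat3 a b c d e f g h i) = a + e + i"
  by (simp add: trace_def sum_3)

lemma mat3_det: "det (mat3 a b c d e f g h i) = a*e*i + b*f*g + c*d*h - a*f*h - b*d*i - c*e*g"
  by (simp add: det_3)

lemmas mat3_simps = mat3_eq_iff mat3_mult mat3_transpose mat3_uminus mat3_id mat3_trace mat3_det

text \<open>\<open>zref t\<close> is \<open>- rot e1 pi ** zrot t\<close>, a reflection in a plane through \<open>e3\<close>. That plane
  turns at half the rate of \<open>t\<close>.\<close>

definition zrot :: "real \<Rightarrow> real^3^3" where
  "zrot t = mat3 (cos t) (- sin t) 0 (sin t) (cos t) 0 0 0 1"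

definition zref :: "real \<Rightarrow> real^3^3" where
  "zref t = mat3 (- cos t) (sin t) 0 (sin t) (cos t) 0 0 0 1"

lemma rot_e3: "rot e3 t = zrot t"
  unfolding rot_def Let_def norm_axis_1
  by (simp add: zrot_def vec_eq_iff forall_3 matrix_def cross3_def axis_def
      inner_vec_def sum_3)

lemma rot_e1_pi: "rot e1 pi = mat3 1 0 0 0 (-1) 0 0 0 (-1)"
  unfolding rot_def Let_def norm_axis_1
  by (simp add: vec_eq_iff forall_3 matrix_def cross3_def axis_def
      inner_vec_def sum_3)

lemma rot_diagonal: "rot (e1 + e2 + e3) (2 * pi / 3) = mat3 0 0 1 1 0 0 0 1 0"
proof -
  have nrm: "norm (e1 + e2 + e3) = sqrt 3"
    by (simp add: norm_vec_def L2_set_def sum_3 axis_def)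
  have "inverse (sqrt 3) * inverse (sqrt 3) = (1/3 :: real)"
    by (simp flip: inverse_mult_distrib)
  moreover have "sqrt 3 * inverse (sqrt 3) = (1 :: real)" by simp
  ultimately show ?thesis
    unfolding rot_def Let_def nrm
    by (simp add: cos_120 sin_120 vec_eq_iff forall_3 matrix_def cross3_def axis_def
        inner_vec_def sum_3)
qed

lemma zrot_mult: "zrot s ** zrot t = zrot (s + t)"
  by (simp add: zrot_def mat3_simps cos_add sin_add)

lemma zref_zref: "zref s ** zref t = zrot (t - s)"
  by (simp add: zrot_def zref_def mat3_simps cos_diff sin_diff)

lemma zref_zrot: "zref s ** zrot t = zref (s + t)"
  by (simp add: zrot_def zref_def mat3_simps cos_add sin_add)

lemma zrot_zref: "zrot s ** zref t = zref (t - s)"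
  by (simp add: zrot_def zref_def mat3_simps cos_diff sin_diff)

lemma zrot_eq_iff: "zrot s = zrot t \<longleftrightarrow> cos s = cos t \<and> sin s = sin t"
  by (auto simp: zrot_def mat3_simps)

lemma zrot_half_turn: "cos t = -1 \<Longrightarrow> zrot t = zrot pi"
  using sin_squared_eq[of t] by (simp add: zrot_eq_iff)

lemma zrot_0: "zrot 0 = mat 1"
  by (simp add: zrot_def mat3_simps)

lemma zrot_transpose: "transpose (zrot t) = zrot (- t)"
  by (simp add: zrot_def mat3_simps)

lemma zrot_det: "det (zrot t) = 1" and zrot_trace: "trace (zrot t) = 1 + 2 * cos t"
  and zref_trace: "trace (zref t) = 1"
  using sin_cos_squared_add[of t]
  by (auto simp: zrot_def zref_def mat3_simps power2_eq_square algebra_simps)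

lemma orthogonal_zrot: "orthogonal_matrix (zrot t)"
  by (simp add: orthogonal_matrix zrot_transpose zrot_mult zrot_0)


section \<open>Conjugation by orthogonal matrices\<close>

lemma O3_simps [simp]:
  "carrier O3 = {A. orthogonal_matrix A}" "mult O3 = (**)" "one O3 = mat 1"
  by (simp_all add: O3_def)

lemma inv_O3: "orthogonal_matrix A \<Longrightarrow> inv\<^bsub>O3\<^esub> A = transpose A"
  by (rule group.inv_equality[OF group_O3]) (auto simp: orthogonal_matrix_def)

lemma transpose_cancel:
  fixes g :: "real^3^3"
  assumes "orthogonal_matrix g"
  shows "transpose g ** (g ** A) = A" "g ** (transpose g ** A) = A"
  using assms by (simp_all add: matrix_mul_assoc orthogonal_matrix_def)

lemma mem_conj_set_O3:
  assumes g: "orthogonal_matrix g"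
  shows "A \<in> conj_set O3 g S \<longleftrightarrow> transpose g ** A ** g \<in> S"
proof
  assume "A \<in> conj_set O3 g S"
  then obtain B where "B \<in> S" "A = g ** B ** transpose g"
    using g by (auto simp: conj_set_def inv_O3)
  moreover from this have "transpose g ** A ** g = B"
    using g by (simp add: matrix_mul_assoc[symmetric] transpose_cancel)
      (simp add: orthogonal_matrix_def)
  ultimately show "transpose g ** A ** g \<in> S" by simp
next
  assume "transpose g ** A ** g \<in> S"
  moreover have "A = g ** (transpose g ** A ** g) ** transpose g"
    using g by (simp add: matrix_mul_assoc[symmetric] transpose_cancel)
      (simp add: orthogonal_matrix_def)
  ultimately show "A \<in> conj_set O3 g S"
    using g by (auto simp: conj_set_def inv_O3)
qed


section \<open>The group \<open>\<T> \<oplus> \<int>\<^sub>2\<^sup>c\<close> as signed cyclic permutation matrices\<close>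

definition signed_cyclic :: "(real^3^3) set" where
  "signed_cyclic = {A. \<exists>a b c. a \<in> {1, -1} \<and> b \<in> {1, -1} \<and> c \<in> {1, -1} \<and>
     (A = mat3 a 0 0 0 b 0 0 0 c \<or> A = mat3 0 0 a b 0 0 0 c 0 \<or> A = mat3 0 a 0 0 0 b c 0 0)}"

lemma signed_cyclicE:
  assumes "A \<in> signed_cyclic"
  obtains a b c where "a \<in> {1, -1}" "b \<in> {1, -1}" "c \<in> {1, -1}" "A = mat3 a 0 0 0 b 0 0 0 c"
  | a b c where "a \<in> {1, -1}" "b \<in> {1, -1}" "c \<in> {1, -1}" "A = mat3 0 0 a b 0 0 0 c 0"
  | a b c where "a \<in> {1, -1}" "b \<in> {1, -1}" "c \<in> {1, -1}" "A = mat3 0 a 0 0 0 b c 0 0"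
  using assms unfolding signed_cyclic_def mem_Collect_eq by (elim exE conjE disjE)

lemma signed_cyclicI:
  assumes "a \<in> {1, -1}" "b \<in> {1, -1}" "c \<in> {1, -1}"
  shows "mat3 a 0 0 0 b 0 0 0 c \<in> signed_cyclic" "mat3 0 0 a b 0 0 0 c 0 \<in> signed_cyclic"
    "mat3 0 a 0 0 0 b c 0 0 \<in> signed_cyclic"
  unfolding signed_cyclic_def mem_Collect_eq
  by (rule exI[of _ a], rule exI[of _ b], rule exI[of _ c], intro conjI assms disjI1 refl,
      rule exI[of _ a], rule exI[of _ b], rule exI[of _ c],
      intro conjI assms, rule disjI2, rule disjI1, rule refl,
      rule exI[of _ a], rule exI[of _ b], rule exI[of _ c],
      intro conjI assms, rule disjI2, rule disjI2, rule refl)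

lemma signed_cyclic_mult:
  assumes "A \<in> signed_cyclic" "B \<in> signed_cyclic"
  shows "A ** B \<in> signed_cyclic"
proof -
  have sgn: "x * y \<in> {1, -1}" if "x \<in> {1, -1}" "y \<in> {1, -1}" for x y :: real
    using that by auto
  show ?thesis
    by (rule signed_cyclicE[OF assms(1)]; rule signed_cyclicE[OF assms(2)];
        simp only: mat3_mult mult_zero_left mult_zero_right add_0_left add_0_right;
        intro signed_cyclicI sgn; assumption)
qed

lemma signed_cyclic_orthogonal: "A \<in> signed_cyclic \<Longrightarrow> orthogonal_matrix A"
  by (erule signed_cyclicE) (auto simp: orthogonal_matrix mat3_simps)

lemma mat_1_signed_cyclic: "mat 1 \<in> signed_cyclic"
  by (simp add: mat3_id signed_cyclicI)

text \<open>The determinant of a signed cyclic permutation matrix is the product of its signs. The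
  matrices with product \<open>1\<close> are the four diagonal ones, namely the identity and the half-turns
  about the coordinate axes, times the powers of the generator of order three.\<close>

lemma T_grp_eq: "T_grp = {A \<in> signed_cyclic. det A = 1}"
proof (intro equalityI subsetI)
  let ?G = "{rot e3 pi, rot e1 pi, rot (e1 + e2 + e3) (2 * pi / 3)}"
  have gens: "?G = {mat3 (-1) 0 0 0 (-1) 0 0 0 1, mat3 1 0 0 0 (-1) 0 0 0 (-1),
      mat3 0 0 1 1 0 0 0 1 0}"
    by (simp add: rot_e3 zrot_def rot_e1_pi rot_diagonal)
  {
    fix A assume "A \<in> T_grp"
    then have "A \<in> generate O3 ?G" by (simp add: T_grp_def)
    then show "A \<in> {A \<in> signed_cyclic. det A = 1}"
    proof (induction A rule: generate.induct)
      case one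
      then show ?case by (simp add: mat_1_signed_cyclic)
    next
      case (incl h)
      then show ?case unfolding gens by (auto simp: mat3_det intro!: signed_cyclicI)
    next
      case (inv h)
      then have "orthogonal_matrix h"
        unfolding gens by (auto simp: orthogonal_matrix mat3_simps)
      with inv show ?case
        unfolding gens by (auto simp: inv_O3 mat3_transpose mat3_det intro!: signed_cyclicI)
    next
      case (eng h1 h2)
      then show ?case by (auto simp: signed_cyclic_mult det_mul)
    qed
  }
  fix A assume A: "A \<in> {A \<in> signed_cyclic. det A = 1}"
  define p where "p = mat3 0 0 1 1 0 0 0 1 0"
  have mult: "X ** Y \<in> T_grp" if "X \<in> T_grp" "Y \<in> T_grp" for X Y
    using that generate.eng[of X O3 ?G Y] by (simp add: T_grp_def)
  have g1: "mat3 (-1) 0 0 0 (-1) 0 0 0 1 \<in> T_grp" and g2: "mat3 1 0 0 0 (-1) 0 0 0 (-1) \<in> T_grp"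
    and p: "p \<in> T_grp" and one: "mat 1 \<in> T_grp"
    using generate.incl[of _ ?G O3] generate.one[of O3 ?G]
    unfolding T_grp_def p_def gens by auto
  have g3: "mat3 (-1) 0 0 0 1 0 0 0 (-1) \<in> T_grp"
    using mult[OF g1 g2] by (simp add: mat3_mult)
  have diag: "mat3 a 0 0 0 b 0 0 0 c \<in> T_grp"
    if "a \<in> {1, -1}" "b \<in> {1, -1}" "c \<in> {1, -1}" "a * b * c = 1" for a b c
    using that g1 g2 g3 one by (auto simp: mat3_id)
  from A have "A \<in> signed_cyclic" "det A = 1" by auto
  then show "A \<in> T_grp"
  proof (cases rule: signed_cyclicE)
    case (1 a b c)
    then show ?thesis using \<open>det A = 1\<close> diag by (simp add: mat3_det)
  next
    case (2 a b c)
    have "A = mat3 a 0 0 0 b 0 0 0 c ** p" by (simp add: 2 p_def mat3_mult)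
    moreover have "a * b * c = 1" using \<open>det A = 1\<close> by (simp add: 2 mat3_det)
    ultimately show ?thesis using diag[OF 2(1-3)] mult p by simp
  next
    case (3 a b c)
    have "A = mat3 a 0 0 0 b 0 0 0 c ** (p ** p)" by (simp add: 3 p_def mat3_mult)
    moreover have "a * b * c = 1" using \<open>det A = 1\<close> by (simp add: 3 mat3_det)
    ultimately show ?thesis using diag[OF 3(1-3)] mult p by simp
  qed
qed

lemma plus_Z2c_T_grp: "plus_Z2c T_grp = signed_cyclic"
proof (intro equalityI subsetI)
  have neg: "- A \<in> signed_cyclic" if "A \<in> signed_cyclic" for A
    using that by (cases rule: signed_cyclicE) (auto simp: mat3_uminus intro!: signed_cyclicI)
  {
    fix A assume "A \<in> plus_Z2c T_grp"
    then show "A \<in> signed_cyclic" by (auto simp: plus_Z2c_def T_grp_eq neg)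
  }
  fix A assume A: "A \<in> signed_cyclic"
  then have "det A = 1 \<or> det (- A) = 1"
    by (cases rule: signed_cyclicE) (auto simp: mat3_det mat3_uminus)
  then show "A \<in> plus_Z2c T_grp"
  proof
    assume "det (- A) = 1"
    then have "- A \<in> T_grp" using neg[OF A] by (simp add: T_grp_eq)
    then show ?thesis unfolding plus_Z2c_def by (metis UnCI image_eqI minus_minus)
  qed (use A in \<open>simp add: plus_Z2c_def T_grp_eq\<close>)
qed

text \<open>The next two facts mention only trace and determinant, so that they carry over to all
  conjugates. A diagonal matrix of signs with determinant \<open>1\<close> has zero or two entries \<open>-1\<close>, and a
  matrix belonging to a nontrivial cyclic permutation has zero diagonal. Trace \<open>1\<close> therefore
  forces a diagonal matrix with a single entry \<open>-1\<close>.\<close>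

lemma signed_cyclic_trace_rotation:
  assumes "A \<in> signed_cyclic" "det A = 1"
  shows "trace A \<in> {3, -1, 0}"
  using assms by (cases rule: signed_cyclicE) (auto simp: mat3_trace mat3_det)

lemma signed_cyclic_trace_reflections:
  assumes "A \<in> signed_cyclic" "B \<in> signed_cyclic" "trace A = 1" "trace B = 1"
  shows "trace (A ** B) \<in> {3, -1}"
  using assms(3,4)
  by (rule_tac signed_cyclicE[OF assms(1)]; rule_tac signed_cyclicE[OF assms(2)])
     (auto simp: mat3_trace mat3_mult)


section \<open>Conjugates of \<open>\<T> \<oplus> \<int>\<^sub>2\<^sup>c\<close>\<close>

definition Th :: "real^3^3 \<Rightarrow> (real^3^3) set" where
  "Th g = conj_set O3 g (plus_Z2c T_grp)"

lemma mem_Th: "orthogonal_matrix g \<Longrightarrow> A \<in> Th g \<longleftrightarrow> transpose g ** A ** g \<in> signed_cyclic"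
  by (simp add: Th_def mem_conj_set_O3 plus_Z2c_T_grp)

lemma trace_conj:
  fixes g :: "real^3^3"
  assumes "orthogonal_matrix g"
  shows "trace (transpose g ** A ** g) = trace A"
  using trace_mul_sym[of "transpose g ** A" g] assms
  by (simp add: transpose_cancel)

lemma det_conj:
  fixes g :: "real^3^3"
  assumes "orthogonal_matrix g"
  shows "det (transpose g ** A ** g) = det A"
proof -
  have "det (transpose g) * det g = 1"
    using assms by (metis det_I det_mul orthogonal_matrix_def)
  then show ?thesis by (simp add: det_mul)
qed

lemma conj_mult:
  fixes g :: "real^3^3"
  assumes "orthogonal_matrix g"
  shows "transpose g ** (A ** B) ** g = (transpose g ** A ** g) ** (transpose g ** B ** g)"
  using assms by (simp add: matrix_mul_assoc[symmetric] transpose_cancel)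

lemma Th_mult:
  assumes "orthogonal_matrix g" "A \<in> Th g" "B \<in> Th g"
  shows "A ** B \<in> Th g"
  using assms signed_cyclic_mult by (simp add: mem_Th conj_mult)

lemma Th_one: "orthogonal_matrix g \<Longrightarrow> mat 1 \<in> Th g"
  by (simp add: mem_Th orthogonal_matrix_def mat_1_signed_cyclic)

text \<open>The trace of \<open>zrot t\<close> is \<open>1 + 2 * cos t\<close>; the product of two reflections \<open>zref s\<close>, \<open>zref t\<close>
  is again a rotation.\<close>

lemma Th_zrot_cos:
  assumes "orthogonal_matrix g" "zrot t \<in> Th g"
  shows "cos t \<in> {1, -1, -1/2}"
  using signed_cyclic_trace_rotation[of "transpose g ** zrot t ** g"] assms
  by (auto simp: mem_Th det_conj trace_conj zrot_det zrot_trace)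

lemma Th_zref_zref:
  assumes "orthogonal_matrix g" "zref s \<in> Th g" "zref t \<in> Th g"
  shows "sin (t - s) = 0"
proof -
  have "trace (zref s ** zref t) \<in> {3, -1}"
    using signed_cyclic_trace_reflections[of "transpose g ** zref s ** g" "transpose g ** zref t ** g"]
      assms by (simp add: mem_Th trace_conj zref_trace flip: conj_mult)
  then have "cos (t - s) = 1 \<or> cos (t - s) = -1"
    by (auto simp: zref_zref zrot_trace)
  then show ?thesis
    using sin_squared_eq[of "t - s"] by auto
qed


section \<open>Cyclic and pyramidal groups about the third axis\<close>

text \<open>Describing \<open>\<int>\<^sub>k\<close> by an equation for the angle, instead of by representatives, makes
  intersections of these groups easy to compute.\<close>

lemma Z_grp_eq:
  assumes "k > 0"
  shows "Z_grp k = {zrot t | t :: real. cos (k * t) = 1}"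
proof (intro equalityI subsetI)
  fix A assume "A \<in> Z_grp k"
  then obtain j where j: "A = zrot (2 * real j * pi / real k)" by (auto simp: Z_grp_def rot_e3)
  have "real k * (2 * real j * pi / real k) = 2 * pi * real j"
    using assms by simp
  then have "cos (real k * (2 * real j * pi / real k)) = 1"
    by (metis cos_2npi mult.commute mult.left_commute)
  then show "A \<in> {zrot t | t :: real. cos (k * t) = 1}" using j by blast
next
  fix A assume "A \<in> {zrot t | t :: real. cos (k * t) = 1}"
  then obtain t :: real where A: "A = zrot t" and "cos (k * t) = 1" by auto
  then obtain m :: int where m: "k * t = real_of_int m * 2 * pi"
    by (auto simp: cos_one_2pi_int)
  define j where "j = nat (m mod int k)"
  have j: "real j = real_of_int (m mod int k)" "j < k"
    using assms by (simp_all add: j_def nat_less_iff)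
  have "real_of_int m = real k * real_of_int (m div int k) + real j"
    unfolding j(1) by (metis mult_div_mod_eq of_int_add of_int_mult of_int_of_nat_eq)
  then have "t = 2 * real j * pi / real k + 2 * pi * real_of_int (m div int k)"
    using m assms by (simp add: field_simps)
  then have "A = zrot (2 * real j * pi / real k)"
    unfolding A zrot_eq_iff using sin_cos_eq_iff by blast
  then show "A \<in> Z_grp k" using j(2) by (auto simp: Z_grp_def rot_e3)
qed

lemma cos_mult_nat_cong:
  assumes "cos s = cos t" "sin s = sin t"
  shows "cos (real k * s) = cos (real k * t)"
proof -
  obtain m :: int where "s = t + 2 * pi * m" using assms sin_cos_eq_iff[of s t] by auto
  then have "k * s = k * t + 2 * pi * of_int (int k * m)" by (simp add: algebra_simps)
  then show ?thesis using sin_cos_eq_iff by blast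
qed

lemma Z_grp_one: "Z_grp 1 = triv_grp"
  by (simp add: Z_grp_def triv_grp_def rot_e3 zrot_0)

text \<open>This is \<open>\<int>\<^sub>a \<inter> \<int>\<^sub>b = \<int>\<^sub>g\<close> with \<open>g = gcd a b\<close>, by Bezout's identity.\<close>

lemma cos_gcd_one_iff:
  "cos (real (gcd a b) * t) = 1 \<longleftrightarrow> cos (real a * t) = 1 \<and> cos (real b * t) = 1"
proof
  assume g: "cos (real (gcd a b) * t) = 1"
  have "cos (real (gcd a b * q) * t) = 1" for q
    using cos_mult_nat_cong[of "gcd a b * t" 0 q] g cos_one_sin_zero[OF g] by (simp add: mult_ac)
  then show "cos (real a * t) = 1 \<and> cos (real b * t) = 1"
    by (metis dvdE gcd_dvd1 gcd_dvd2)
next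
  assume "cos (real a * t) = 1 \<and> cos (real b * t) = 1"
  then obtain m l :: int where m: "a * t = m * 2 * pi" and l: "b * t = l * 2 * pi"
    by (auto simp: cos_one_2pi_int)
  obtain u v where "u * int a + v * int b = int (gcd a b)"
    using bezout_int[of "int a" "int b"] by (auto simp: gcd_int_int_eq)
  then have "real (gcd a b) = u * real a + v * real b"
    by (metis of_int_add of_int_mult of_int_of_nat_eq)
  then have "gcd a b * t = u * (a * t) + v * (b * t)" by (simp add: algebra_simps)
  also have "\<dots> = real_of_int (u * m + v * l) * 2 * pi"
    unfolding m l by (simp add: algebra_simps)
  finally show "cos (real (gcd a b) * t) = 1"
    unfolding cos_one_2pi_int by blast
qed

text \<open>The pyramidal group \<open>C\<^sub>k\<^sub>v\<close> about \<open>e3\<close> that contains the reflection \<open>zref s\<close>.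
  The case \<open>k = 1\<close> is included: it gives the group of order two generated by \<open>zref s\<close>, which is
  conjugate to \<open>Z2minus\<close> but never equal to it.\<close>

definition pyramidal :: "nat \<Rightarrow> real \<Rightarrow> (real^3^3) set" where
  "pyramidal k s = {zrot t | t :: real. cos (k * t) = 1} \<union> {zref t | t :: real. cos (k * (t - s)) = 1}"

lemma Dz_grp_eq: "n \<ge> 2 \<Longrightarrow> Dz_grp n = pyramidal n 0"
proof -
  assume n: "n \<ge> 2"
  have "(- rot e1 pi) ** zrot t = zref t" for t
    by (simp add: rot_e1_pi zrot_def zref_def mat3_simps)
  then have "(\<lambda>A. (- rot e1 pi) ** A) ` Z_grp n = {zref t | t :: real. cos (n * t) = 1}"
    using n by (fastforce simp: Z_grp_eq image_iff)
  then show ?thesis using n by (simp add: Dz_grp_def pyramidal_def Z_grp_eq)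
qed

text \<open>Conjugation by \<open>zrot u\<close> maps \<open>zref t\<close> to \<open>zref (t - 2 * u)\<close>, whence the half angle.\<close>

lemma conj_set_pyramidal: "conj_set O3 (zrot (- s / 2)) (pyramidal k 0) = pyramidal k s"
proof (rule Set.set_eqI)
  fix A
  have inner: "transpose (zrot (- s / 2)) ** zrot t ** zrot (- s / 2) = zrot t"
    "transpose (zrot (- s / 2)) ** zref t ** zrot (- s / 2) = zref (t - s)" for t
    by (simp_all add: zrot_transpose zrot_mult zrot_zref zref_zrot)
  show "A \<in> conj_set O3 (zrot (- s / 2)) (pyramidal k 0) \<longleftrightarrow> A \<in> pyramidal k s"
  proof
    assume "A \<in> conj_set O3 (zrot (- s / 2)) (pyramidal k 0)"
    then obtain B where B: "B \<in> pyramidal k 0" "A = zrot (- s / 2) ** B ** zrot (s / 2)"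
      by (auto simp: conj_set_def orthogonal_zrot inv_O3 zrot_transpose)
    then show "A \<in> pyramidal k s"
      by (force simp: pyramidal_def zrot_mult zrot_zref zref_zrot)
  next
    assume "A \<in> pyramidal k s"
    then consider t :: real where "A = zrot t" "cos (k * t) = 1"
      | t :: real where "A = zref t" "cos (k * (t - s)) = 1"
      by (auto simp: pyramidal_def)
    then show "A \<in> conj_set O3 (zrot (- s / 2)) (pyramidal k 0)"
    proof cases
      case (1 t)
      then show ?thesis
        unfolding mem_conj_set_O3[OF orthogonal_zrot] 1(1) inner by (auto simp: pyramidal_def)
    next
      case (2 t)
      then show ?thesis
        unfolding mem_conj_set_O3[OF orthogonal_zrot] 2(1) inner by (auto simp: pyramidal_def)
    qed
  qed
qed

lemma pyramidal_one: "conj_class O3 (pyramidal 1 0) = conj_class O3 Z2minus"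
proof -
  \<comment> \<open>The permutation matrix that exchanges \<open>e1\<close> and \<open>e3\<close> maps one mirror plane to the other.\<close>
  let ?q = "mat3 0 0 1 0 1 0 1 0 0"
  have q: "orthogonal_matrix ?q" by (simp add: orthogonal_matrix mat3_simps)
  have "zrot t = mat 1" "zref t = mat3 (-1) 0 0 0 1 0 0 0 1" if "cos t = 1" for t
    using cos_one_sin_zero[OF that] that by (simp_all add: zrot_def zref_def mat3_simps)
  then have pyr: "pyramidal 1 0 = {mat 1, mat3 (-1) 0 0 0 1 0 0 0 1}"
    unfolding pyramidal_def by (auto intro!: exI[of _ 0] simp: zrot_0 zref_def mat3_eq_iff)
  have Z2m: "Z2minus = {mat 1, mat3 1 0 0 0 1 0 0 0 (-1)}"
    by (simp add: Z2minus_def rot_e3 zrot_def mat3_simps)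
  have "conj_set O3 ?q Z2minus = pyramidal 1 0"
    unfolding pyr Z2m by (simp add: conj_set_def inv_O3[OF q] mat3_simps)
  moreover have "Z2minus \<subseteq> carrier O3"
    unfolding Z2m by (simp add: orthogonal_matrix mat3_simps)
  ultimately show ?thesis
    using group.conj_class_conj_set[OF group_O3, of ?q Z2minus] q by simp
qed

lemma pyramidal_subset: "pyramidal k s \<subseteq> carrier O3"
proof -
  have "orthogonal_matrix (zref t)" for t
    using sin_cos_squared_add[of t]
    by (simp add: orthogonal_matrix zref_def mat3_simps power2_eq_square algebra_simps)
  then show ?thesis by (auto simp: pyramidal_def orthogonal_zrot)
qed

lemma conj_class_pyramidal:
  assumes "k > 0"
  shows "conj_class O3 (pyramidal k s) = conj_class O3 (Dz_grp k)"
proof -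
  have "conj_class O3 (pyramidal k s) = conj_class O3 (pyramidal k 0)"
    using group.conj_class_conj_set[OF group_O3, of "zrot (- s / 2)" "pyramidal k 0"]
    unfolding conj_set_pyramidal using pyramidal_subset by (simp add: orthogonal_zrot)
  also have "\<dots> = conj_class O3 (Dz_grp k)"
    using assms by (cases "k = 1") (simp_all add: pyramidal_one[simplified] Dz_grp_eq, simp add: Dz_grp_def)
  finally show ?thesis .
qed


section \<open>Intersections\<close>

text \<open>The angles allowed by \<open>Th_zrot_cos\<close> are \<open>0\<close>, \<open>pi\<close> and \<open>\<plusminus> 2 * pi / 3\<close>. A half-turn and a
  third of a turn about the same axis do not occur together, because their product would be a sixth
  of a turn; and a third of a turn in one direction generates that in the other.\<close>

lemma Th_axial_rotations:
  assumes g: "orthogonal_matrix g"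
  obtains m :: nat where "m \<in> {1, 2, 3}" "\<And>t. zrot t \<in> Th g \<longleftrightarrow> cos (real m * t) = 1"
proof -
  note mult = Th_mult[OF g, of "zrot s" "zrot t" for s t, unfolded zrot_mult]
  have one: "zrot t \<in> Th g" if "cos t = 1" for t
  proof -
    have "zrot t = mat 1"
      using that cos_one_sin_zero[OF that] by (simp add: zrot_eq_iff flip: zrot_0)
    then show ?thesis using Th_one[OF g] by simp
  qed
  consider "zrot pi \<in> Th g" | t0 where "zrot t0 \<in> Th g" "cos t0 = -1/2" "zrot pi \<notin> Th g"
    | "zrot pi \<notin> Th g" "\<And>t. zrot t \<in> Th g \<Longrightarrow> cos t \<noteq> -1/2" by blast
  then show ?thesis
  proof cases
    case 1
    have "zrot t \<in> Th g \<longleftrightarrow> cos (2 * t) = 1" for t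
    proof
      assume t: "zrot t \<in> Th g"
      have "cos (t + pi) \<in> {1, -1, -1/2}" "cos t \<in> {1, -1, -1/2}"
        using Th_zrot_cos[OF g] mult[OF t 1] t by blast+
      then show "cos (2 * t) = 1" by (auto simp: cos_double_cos)
    next
      assume "cos (2 * t) = 1"
      then have "cos t = 1 \<or> cos t = -1"
        by (simp add: cos_double_cos power2_eq_1_iff)
      then show "zrot t \<in> Th g"
      proof
        assume "cos t = -1"
        then show ?thesis using 1 by (metis zrot_half_turn)
      qed (rule one)
    qed
    then show ?thesis using that[of 2] by simp
  next
    case 2
    have sq: "(sin t)\<^sup>2 = (sin t0)\<^sup>2" if "cos t = -1/2" for t
      using sin_squared_eq[of t] sin_squared_eq[of t0] that 2(2) by simp
    have "zrot t \<in> Th g \<longleftrightarrow> cos (3 * t) = 1" for t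
    proof
      assume t: "zrot t \<in> Th g"
      have "cos t \<noteq> -1"
        using t \<open>zrot pi \<notin> Th g\<close> zrot_half_turn by metis
      then have "cos t = 1 \<or> cos t = -1/2"
        using Th_zrot_cos[OF g t] by blast
      then show "cos (3 * t) = 1" by (auto simp: cos_treble_cos power3_eq_cube)
    next
      assume "cos (3 * t) = 1"
      then have "4 * cos t ^ 3 - 3 * cos t = 1" by (simp add: cos_treble_cos)
      then have "(cos t - 1) * (2 * cos t + 1)\<^sup>2 = 0"
        by (simp add: algebra_simps power2_eq_square power3_eq_cube)
      then have "cos t = 1 \<or> cos t = -1/2" by auto
      then show "zrot t \<in> Th g"
      proof
        assume c: "cos t = -1/2"
        then have "sin t = sin t0 \<or> sin t = - sin t0"
          using sq power2_eq_iff by blast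
        moreover have "cos (t0 + t0) = -1/2" "sin (t0 + t0) = - sin t0"
          using 2(2) sin_double[of t0] cos_double_cos[of t0] by (simp_all add: power2_eq_square)
        ultimately have "zrot t = zrot t0 \<or> zrot t = zrot (t0 + t0)"
          using c 2(2) by (auto simp: zrot_eq_iff)
        then show ?thesis using 2(1) mult[OF 2(1) 2(1)] by auto
      qed (rule one)
    qed
    then show ?thesis using that[of 3] by simp
  next
    case 3
    have "zrot t \<in> Th g \<longleftrightarrow> cos t = 1" for t
    proof
      assume t: "zrot t \<in> Th g"
      have "cos t \<noteq> -1"
        using t \<open>zrot pi \<notin> Th g\<close> zrot_half_turn by metis
      then show "cos t = 1" using Th_zrot_cos[OF g t] 3(2)[OF t] by blast
    qed (rule one)
    then show ?thesis using that[of 1] by simp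
  qed
qed

text \<open>A rotation of order three would turn the given reflection into another one, whose plane is
  neither equal nor perpendicular to the given plane.\<close>

lemma Th_reflection_no_threefold:
  assumes g: "orthogonal_matrix g" and "zref s \<in> Th g"
  shows "zrot (2 * pi / 3) \<notin> Th g"
proof
  assume "zrot (2 * pi / 3) \<in> Th g"
  from Th_mult[OF g assms(2) this] have "zref (s + 2 * pi / 3) \<in> Th g"
    by (simp add: zref_zrot)
  then have "sin (2 * pi / 3) = 0" using Th_zref_zref[OF g assms(2)] by fastforce
  then show False by (simp add: sin_120)
qed

lemma Dz_Int_Th_rotations:
  assumes "orthogonal_matrix g" "n \<ge> 2" "m > 0"
    and m: "\<And>t. zrot t \<in> Th g \<longleftrightarrow> cos (real m * t) = 1"
    and no: "\<And>t. cos (real n * t) = 1 \<Longrightarrow> zref t \<notin> Th g"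
  shows "Dz_grp n \<inter> Th g = Z_grp (gcd m n)"
  using assms(2,3) no
  by (auto simp: Dz_grp_eq pyramidal_def Z_grp_eq m cos_gcd_one_iff)

text \<open>Multiplication by the common reflection \<open>zref s\<close> exchanges rotations and reflections in both
  groups, so the common rotations determine the common reflections.\<close>

lemma Dz_Int_Th_reflection:
  assumes g: "orthogonal_matrix g" and n: "n \<ge> 2" and "m > 0"
    and m: "\<And>t. zrot t \<in> Th g \<longleftrightarrow> cos (real m * t) = 1"
    and s: "cos (real n * s) = 1" "zref s \<in> Th g"
  shows "Dz_grp n \<inter> Th g = pyramidal (gcd m n) s"
proof -
  have "cos (real n * t) = 1 \<longleftrightarrow> cos (real n * (t - s)) = 1" for t
    using s(1) cos_one_sin_zero[OF s(1)] by (simp add: right_diff_distrib cos_diff)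
  moreover have "zref t \<in> Th g \<longleftrightarrow> cos (real m * (t - s)) = 1" for t
    using Th_mult[OF g s(2), of "zref t"] Th_mult[OF g s(2), of "zrot (t - s)"]
    by (auto simp: zref_zref zref_zrot m)
  ultimately show ?thesis
    using n by (auto simp: Dz_grp_eq pyramidal_def m cos_gcd_one_iff)
qed

lemma clips_Dz_Th:
  assumes "n \<ge> 2"
  shows "clips O3 (conj_class O3 (Dz_grp n)) (conj_class O3 (plus_Z2c T_grp)) =
    {conj_class O3 (Dz_grp n \<inter> Th g) | g. orthogonal_matrix g}"
proof -
  have "Dz_grp n \<subseteq> carrier O3" using assms pyramidal_subset by (simp add: Dz_grp_eq)
  moreover have "plus_Z2c T_grp \<subseteq> carrier O3"
    using signed_cyclic_orthogonal by (auto simp: plus_Z2c_T_grp)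
  ultimately show ?thesis
    by (simp add: group.clips_conj_class[OF group_O3] Th_def)
qed


section \<open>Position of the tetrahedral axes\<close>

text \<open>When \<open>Th g\<close> is turned by \<open>\<psi>\<close> about \<open>e3\<close>, its reflections \<open>zref t\<close> become
  \<open>zref (t - 2 * \<psi>)\<close>, whereas its rotations about \<open>e3\<close> commute with the turn and stay. By
  \<open>Th_zref_zref\<close> and \<open>zref 0 \<in> Th g\<close> the angles of all reflections \<open>zref t\<close> of \<open>Th g\<close> are multiples of \<open>pi\<close>. For the angle
  \<open>\<psi> = pi / (4 * n)\<close> the turned reflections satisfy \<open>cos (n * t) = 0\<close>, hence are not in
  \<open>\<D>\<^sub>n\<^sup>z\<close>.\<close>

lemma Th_turn:
  assumes g: "orthogonal_matrix g" and M: "zref 0 \<in> Th g" and n: "n \<ge> 2"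
  shows "\<exists>h. orthogonal_matrix h \<and> (\<forall>t. zrot t \<in> Th h \<longleftrightarrow> zrot t \<in> Th g) \<and>
    (\<forall>t. cos (real n * t) = 1 \<longrightarrow> zref t \<notin> Th h)"
proof (intro exI conjI allI impI notI)
  define \<psi> where "\<psi> = pi / (4 * real n)"
  let ?h = "zrot \<psi> ** g"
  show h: "orthogonal_matrix ?h" using g orthogonal_zrot orthogonal_matrix_mul by blast
  have mem: "A \<in> Th ?h \<longleftrightarrow> zrot (- \<psi>) ** A ** zrot \<psi> \<in> Th g" for A
    using g h by (simp add: mem_Th matrix_transpose_mul zrot_transpose matrix_mul_assoc)
  show "zrot t \<in> Th ?h \<longleftrightarrow> zrot t \<in> Th g" for t
    by (simp add: mem zrot_mult)
  fix t assume t: "cos (real n * t) = 1" and "zref t \<in> Th ?h"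
  then have "zref (t + 2 * \<psi>) \<in> Th g" by (simp add: mem zrot_zref zref_zrot add.assoc)
  then have "sin (t + 2 * \<psi>) = 0" using Th_zref_zref[OF g M] by fastforce
  then obtain i :: int where i: "t + 2 * \<psi> = i * pi" by (auto simp: sin_zero_iff_int2)
  have "real n * t = real_of_int (int n * i) * pi - pi / 2"
    using i n by (simp add: \<psi>_def field_simps)
  moreover have "sin (real_of_int (int n * i) * pi) = 0"
    unfolding sin_zero_iff_int2 by blast
  ultimately have "cos (real n * t) = 0"
    by (simp add: cos_diff)
  with t show False by simp
qed

lemma Th_id: "A \<in> Th (mat 1) \<longleftrightarrow> A \<in> signed_cyclic"
  by (simp add: mem_Th orthogonal_matrix_id transpose_mat)

lemma zref_0: "zref 0 = mat3 (-1) 0 0 0 1 0 0 0 1"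
  by (simp add: zref_def)

lemma Th_twofold: "zrot pi \<in> Th (mat 1)" "zref 0 \<in> Th (mat 1)"
  by (auto simp: Th_id zref_0 zrot_def intro!: signed_cyclicI)

text \<open>A turn about \<open>e1\<close> keeps \<open>zref 0\<close>, the reflection in the plane orthogonal to \<open>e1\<close>.
  The angle of the 3-4-5 triangle is not a multiple of a quarter turn, so \<open>e3\<close> leaves the
  two-fold axes.\<close>

lemma Th_oblique:
  "\<exists>g. orthogonal_matrix g \<and> zref 0 \<in> Th g \<and> zrot pi \<notin> Th g"
proof (intro exI conjI notI)
  let ?g = "mat3 1 0 0 0 (4/5) (-3/5) 0 (3/5) (4/5)"
  show g: "orthogonal_matrix ?g" by (simp add: orthogonal_matrix mat3_simps)
  show "zref 0 \<in> Th ?g"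
    unfolding mem_Th[OF g] by (auto simp: zref_0 mat3_simps intro!: signed_cyclicI)
  assume "zrot pi \<in> Th ?g"
  then show False
    unfolding mem_Th[OF g] by (auto simp: zrot_def mat3_simps elim!: signed_cyclicE)
qed

text \<open>The columns of the witness are an orthonormal basis that a third of a turn about \<open>e3\<close>
  permutes cyclically, so that \<open>e3\<close> points along the diagonal of this basis.\<close>

lemma Th_threefold: "\<exists>g. orthogonal_matrix g \<and> zrot (2 * pi / 3) \<in> Th g"
proof (intro exI conjI)
  define a b :: real where "a = sqrt (1/2)" and "b = sqrt (1/3)"
  have ab: "a * a = 1/2" "b * b = 1/3" by (simp_all add: a_def b_def flip: real_sqrt_mult)
  have ab': "a * (a * x) = x/2" "b * (b * x) = x/3" for x using ab by (simp_all flip: mult.assoc)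
  have s3: "sqrt 3 = 3 * b" by (simp add: b_def real_sqrt_divide real_div_sqrt)
  let ?g = "mat3 (2*a*b) (-a*b) (-a*b) 0 a (-a) b b b"
  show g: "orthogonal_matrix ?g"
    by (simp add: orthogonal_matrix mat3_simps ab ab' algebra_simps)
  have zr: "zrot (2 * pi / 3) = mat3 (-1/2) (-3*b/2) 0 (3*b/2) (-1/2) 0 0 0 1"
    unfolding zrot_def cos_120 sin_120 s3 by (simp add: mat3_eq_iff)
  have "transpose ?g ** zrot (2 * pi / 3) ** ?g = mat3 0 0 1 1 0 0 0 1 0"
    unfolding zr by (simp add: mat3_simps ab ab' algebra_simps)
  then show "zrot (2 * pi / 3) \<in> Th ?g"
    unfolding mem_Th[OF g] by (simp add: signed_cyclicI)
qed


theorem lemma4p9: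
  fixes n d\<^sub>2 d\<^sub>3 :: nat
  assumes "n \<ge> 2"
    and "d\<^sub>2 = gcd 2 n"
    and "d\<^sub>3 = gcd 3 n"
  shows "clips O3 (conj_class O3 (Dz_grp n)) (conj_class O3 (plus_Z2c T_grp)) =
    {conj_class O3 triv_grp, conj_class O3 Z2minus, conj_class O3 (Z_grp d\<^sub>2),
     conj_class O3 (Z_grp d\<^sub>3), conj_class O3 (Dz_grp d\<^sub>2)}" (is "?L = ?R")
proof (intro equalityI subsetI)
  have Dz1: "Dz_grp (Suc 0) = Z2minus" by (simp add: Dz_grp_def)
  {
    fix C assume "C \<in> ?L"
    then obtain g where g: "orthogonal_matrix g" and C: "C = conj_class O3 (Dz_grp n \<inter> Th g)"
      using clips_Dz_Th[OF assms(1)] by auto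
    obtain m :: nat where m: "m \<in> {1, 2, 3}" "\<And>t. zrot t \<in> Th g \<longleftrightarrow> cos (real m * t) = 1"
      by (rule Th_axial_rotations[OF g]) (rule that)
    then have "m > 0" by auto
    show "C \<in> ?R"
    proof (cases "\<exists>s. cos (real n * s) = 1 \<and> zref s \<in> Th g")
      case True
      then obtain s where s: "cos (real n * s) = 1" "zref s \<in> Th g" by blast
      have "m \<noteq> 3" using Th_reflection_no_threefold[OF g s(2)] m(2)[of "2 * pi / 3"] by auto
      moreover have "C = conj_class O3 (Dz_grp (gcd m n))"
        using C Dz_Int_Th_reflection[OF g assms(1) \<open>m > 0\<close> m(2) s] \<open>m > 0\<close>
        by (simp add: conj_class_pyramidal)
      ultimately show ?thesis using m(1) assms by (auto simp: Dz1)
    next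
      case False
      then have "C = conj_class O3 (Z_grp (gcd m n))"
        using C Dz_Int_Th_rotations[OF g assms(1) \<open>m > 0\<close> m(2)] by auto
      then show ?thesis using m(1) assms Z_grp_one by auto
    qed
  }
  have in_L: "conj_class O3 (Dz_grp n \<inter> Th g) \<in> ?L" if "orthogonal_matrix g" for g
    using clips_Dz_Th[OF assms(1)] that by auto
  \<comment> \<open>Each position with a reflection realizes two classes, the second one after a turn about \<open>e3\<close>.\<close>
  have pair: "conj_class O3 (Dz_grp (gcd m n)) \<in> ?L \<and> conj_class O3 (Z_grp (gcd m n)) \<in> ?L"
    if g: "orthogonal_matrix g" "zref 0 \<in> Th g" and "m > 0"
      and m: "\<And>t. zrot t \<in> Th g \<longleftrightarrow> cos (real m * t) = 1" for g m
  proof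
    have "Dz_grp n \<inter> Th g = pyramidal (gcd m n) 0"
      using Dz_Int_Th_reflection[OF g(1) assms(1) \<open>m > 0\<close> m _ g(2)] by simp
    then show "conj_class O3 (Dz_grp (gcd m n)) \<in> ?L"
      using in_L[OF g(1)] \<open>m > 0\<close> by (simp add: conj_class_pyramidal)
    obtain h where h: "orthogonal_matrix h" "\<And>t. zrot t \<in> Th h \<longleftrightarrow> cos (real m * t) = 1"
        "\<And>t. cos (real n * t) = 1 \<Longrightarrow> zref t \<notin> Th h"
      using Th_turn[OF g assms(1)] m by auto
    show "conj_class O3 (Z_grp (gcd m n)) \<in> ?L"
      using in_L[OF h(1)] Dz_Int_Th_rotations[OF h(1) assms(1) \<open>m > 0\<close> h(2,3)] by simp
  qed
  have two: "conj_class O3 (Dz_grp d\<^sub>2) \<in> ?L \<and> conj_class O3 (Z_grp d\<^sub>2) \<in> ?L"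
  proof -
    obtain m :: nat where m: "m \<in> {1, 2, 3}" "\<And>t. zrot t \<in> Th (mat 1) \<longleftrightarrow> cos (real m * t) = 1"
      by (rule Th_axial_rotations[OF orthogonal_matrix_id]) (rule that)
    have "cos (m * pi) = 1" using m(2) Th_twofold(1) by blast
    then have "m = 2" using m(1) by (auto simp: cos_npi)
    then show ?thesis
      using pair[OF orthogonal_matrix_id Th_twofold(2), of 2] m(2) assms(2) by simp
  qed
  have one: "conj_class O3 Z2minus \<in> ?L \<and> conj_class O3 triv_grp \<in> ?L"
  proof -
    obtain g where g: "orthogonal_matrix g" "zref 0 \<in> Th g" "zrot pi \<notin> Th g"
      using Th_oblique by blast
    obtain m :: nat where m: "m \<in> {1, 2, 3}" "\<And>t. zrot t \<in> Th g \<longleftrightarrow> cos (real m * t) = 1"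
      by (rule Th_axial_rotations[OF g(1)]) (rule that)
    have "m \<noteq> 2" using m(2)[of pi] g(3) by auto
    moreover have "m \<noteq> 3"
      using Th_reflection_no_threefold[OF g(1,2)] m(2)[of "2 * pi / 3"] by auto
    ultimately have "m = 1" using m(1) by auto
    then show ?thesis
      using pair[OF g(1,2), of 1] m(2) Z_grp_one by (simp add: Dz1)
  qed
  have three: "conj_class O3 (Z_grp d\<^sub>3) \<in> ?L"
  proof -
    obtain g where g: "orthogonal_matrix g" "zrot (2 * pi / 3) \<in> Th g"
      using Th_threefold by blast
    obtain m :: nat where m: "m \<in> {1, 2, 3}" "\<And>t. zrot t \<in> Th g \<longleftrightarrow> cos (real m * t) = 1"
      by (rule Th_axial_rotations[OF g(1)]) (rule that)
    have "cos (m * (2 * pi / 3)) = 1" using g(2) m(2) by blast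
    then have "m = 3"
      using m(1) cos_120 cos_double_cos[of "2 * pi / 3"] by (auto simp: power2_eq_square)
    moreover have "zref t \<notin> Th g" for t using Th_reflection_no_threefold[OF g(1)] g(2) by blast
    ultimately show ?thesis
      using in_L[OF g(1)] Dz_Int_Th_rotations[OF g(1) assms(1), of 3] m(2) assms(3) by simp
  qed
  fix C assume "C \<in> ?R"
  then show "C \<in> ?L" using one two three by blast
qed

end
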